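(* Let $M$ be a smooth manifold, $\nabla$ a linear connection on $M$, and $E_1,E_2$ two almost product structures on $M$ with $E_1E_2=-E_2E_1$. Let $\alpha,\beta\in\mathbb{R}$ with $\alpha^2+\beta^2=1$ and let $E_{\alpha,\beta}:=\alpha E_1+\beta E_2$, which is an almost product structure. Then for all vector fields $X,Y$ $$\nabla^{(E_{\alpha,\beta})}_XY=\alpha^2\nabla^{(E_1)}_XY+\beta^2\nabla^{(E_2)}_XY+\alpha\beta\,[E_1(\nabla_X(E_2Y))+E_2(\nabla_X(E_1Y))].$$ Moreover: (i) If $E_1$ and $E_2$ are recurrent with respect to $\nabla$ with the same $1$-form $\eta$ of recurrence, i.e. $\nabla E_i=\eta\otimes E_i$ for $i=1,2$, then $\nabla^{(E_1)}=\nabla^{(E_2)}$, and $\nabla^{(E_{\alpha,\beta})}$ equals this common connection. (ii) If there is a $1$-form $\eta$ with $\nabla E_1=\eta\otimes E_2$ and $\nabla E_2=\eta\otimes E_1$, then $\nabla=\frac12(\nabla^{(E_1)}+\nabla^{(E_2)})$ and $$\nabla^{(E_{\alpha,\beta})}=\nabla+(\alpha^2-\beta^2)\,\eta\otimes E_1E_2.$$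
   Context: An almost product structure on $M$ is an endomorphism $E$ of $TM$ with $E^2=I$, the identity. For a linear connection $\nabla$ and an almost product structure $E$, the product conjugate connection is $\nabla^{(E)}_XY:=E(\nabla_X(EY))$, and $(\nabla_XE)Y=\nabla_X(EY)-E(\nabla_XY)$. For a $1$-form $\eta$ and a $(1,1)$-tensor field $F$, $(\eta\otimes F)(X,Y)=\eta(X)FY$; the equation $\nabla E=\eta\otimes F$ means $(\nabla_XE)Y=\eta(X)FY$ for all vector fields $X,Y$. *)

theory Defs
  imports "HOL-Analysis.Analysis" "HOL-Library.Function_Algebras"
begin

text \<open>
  Together with Function_Algebras, the following instance equips all function types with the
  pointwise real vector space structure.  It is used for real functions on the manifold, for
  tangent vectors, for vector fields and for fields of endomorphisms.
\<close>

instantiation "fun" :: (type, real_vector) real_vector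
begin

definition "c *\<^sub>R f = (\<lambda>x. c *\<^sub>R f x)"

instance
  by standard (simp_all add: scaleR_fun_def fun_eq_iff scaleR_add_right scaleR_add_left)

end

lemma scaleR_fun_apply [simp]: "(c *\<^sub>R f) x = c *\<^sub>R f x"
  by (simp add: scaleR_fun_def)


text \<open>
  \<open>Ck_on k S f\<close> is used for open \<open>S\<close> in a finite-dimensional space only; there, continuity
  of all directional derivatives is continuity of the derivative.
\<close>

primrec Ck_on :: "nat \<Rightarrow> 'b::real_normed_vector set \<Rightarrow> ('b \<Rightarrow> 'c::real_normed_vector) \<Rightarrow> bool" where
  "Ck_on 0 S f \<longleftrightarrow> continuous_on S f"
| "Ck_on (Suc k) S f \<longleftrightarrow>
     (\<forall>x\<in>S. f differentiable (at x)) \<and> (\<forall>v. Ck_on k S (\<lambda>x. frechet_derivative f (at x) v))"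

definition smooth_on :: "'b::real_normed_vector set \<Rightarrow> ('b \<Rightarrow> 'c::real_normed_vector) \<Rightarrow> bool" where
  "smooth_on S f \<longleftrightarrow> (\<forall>k. Ck_on k S f)"


text \<open>
  The manifold is a whole type \<open>'a\<close>; being Hausdorff and second countable are its sort
  constraints.  The model space is a finite-dimensional normed space and not a
  \<open>euclidean_space\<close>, because that class excludes dimension 0.  An atlas is not required to be
  maximal.
\<close>

type_synonym ('a, 'b) chart = "'a set \<times> ('a \<Rightarrow> 'b)"

definition smooth_manifold ::
    "('a::{t2_space, second_countable_topology}, 'b::real_normed_vector) chart set \<Rightarrow> bool" where
  "smooth_manifold A \<longleftrightarrow>
     (\<exists>B::'b set. finite B \<and> span B = UNIV) \<and>
     (\<forall>(U, \<phi>)\<in>A. open U \<and> open (\<phi> ` U) \<and> homeomorphism U (\<phi> ` U) \<phi> (inv_into U \<phi>)) \<and>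
     (\<Union>(U, \<phi>)\<in>A. U) = UNIV \<and>
     (\<forall>(U, \<phi>)\<in>A. \<forall>(V, \<psi>)\<in>A. smooth_on (\<phi> ` (U \<inter> V)) (\<psi> \<circ> inv_into U \<phi>))"

definition smooth_fun :: "('a, 'b::real_normed_vector) chart set \<Rightarrow> ('a \<Rightarrow> real) set" where
  "smooth_fun A = {f. \<forall>(U, \<phi>)\<in>A. smooth_on (\<phi> ` U) (f \<circ> inv_into U \<phi>)}"


text \<open>
  Tangent vectors at \<open>p\<close> are the derivations at \<open>p\<close> of the algebra of smooth functions.  They
  take the value 0 on non-smooth functions, so that two tangent vectors are the same derivation
  iff they are equal in HOL.
\<close>

type_synonym 'a tvec = "('a \<Rightarrow> real) \<Rightarrow> real"
type_synonym 'a vfield = "'a \<Rightarrow> 'a tvec"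

definition tangent_space :: "('a, 'b::real_normed_vector) chart set \<Rightarrow> 'a \<Rightarrow> 'a tvec set" where
  "tangent_space A p =
     {v. (\<forall>f\<in>smooth_fun A. \<forall>g\<in>smooth_fun A. v (f + g) = v f + v g) \<and>
         (\<forall>c. \<forall>f\<in>smooth_fun A. v (c *\<^sub>R f) = c * v f) \<and>
         (\<forall>f\<in>smooth_fun A. \<forall>g\<in>smooth_fun A. v (f * g) = f p * v g + g p * v f) \<and>
         (\<forall>f. f \<notin> smooth_fun A \<longrightarrow> v f = 0)}"

definition vector_fields :: "('a, 'b::real_normed_vector) chart set \<Rightarrow> 'a vfield set" where
  "vector_fields A =
     {X. (\<forall>p. X p \<in> tangent_space A p) \<and>
         (\<forall>f\<in>smooth_fun A. (\<lambda>p. X p f) \<in> smooth_fun A)}"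

definition linear_on_fibre :: "('a, 'b::real_normed_vector) chart set \<Rightarrow> 'a \<Rightarrow>
    ('a tvec \<Rightarrow> 'c::real_vector) \<Rightarrow> bool" where
  "linear_on_fibre A p L \<longleftrightarrow>
     (\<forall>u\<in>tangent_space A p. \<forall>v\<in>tangent_space A p. L (u + v) = L u + L v) \<and>
     (\<forall>c. \<forall>v\<in>tangent_space A p. L (c *\<^sub>R v) = c *\<^sub>R L v)"

definition one_form :: "('a, 'b::real_normed_vector) chart set \<Rightarrow> ('a \<Rightarrow> 'a tvec \<Rightarrow> real) \<Rightarrow> bool" where
  "one_form A \<eta> \<longleftrightarrow>
     (\<forall>p. linear_on_fibre A p (\<eta> p)) \<and>
     (\<forall>X\<in>vector_fields A. (\<lambda>p. \<eta> p (X p)) \<in> smooth_fun A)"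


type_synonym 'a endo = "'a \<Rightarrow> 'a tvec \<Rightarrow> 'a tvec"

definition endo_app :: "'a endo \<Rightarrow> 'a vfield \<Rightarrow> 'a vfield"  (infixr "\<star>" 80) where
  "E \<star> X = (\<lambda>p. E p (X p))"

definition endo_comp :: "'a endo \<Rightarrow> 'a endo \<Rightarrow> 'a endo" where
  "endo_comp E F = (\<lambda>p v. E p (F p v))"

text \<open>
  The values of \<open>E p\<close> outside the tangent space at \<open>p\<close> are irrelevant, hence equations between
  endomorphisms of the tangent bundle are stated on the tangent spaces.
\<close>

definition bundle_endomorphism :: "('a, 'b::real_normed_vector) chart set \<Rightarrow> 'a endo \<Rightarrow> bool" where
  "bundle_endomorphism A E \<longleftrightarrow>
     (\<forall>p. linear_on_fibre A p (E p) \<and> E p ` tangent_space A p \<subseteq> tangent_space A p) \<and>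
     (\<forall>X\<in>vector_fields A. E \<star> X \<in> vector_fields A)"

definition almost_product_structure :: "('a, 'b::real_normed_vector) chart set \<Rightarrow> 'a endo \<Rightarrow> bool" where
  "almost_product_structure A E \<longleftrightarrow>
     bundle_endomorphism A E \<and> (\<forall>p. \<forall>v\<in>tangent_space A p. endo_comp E E p v = v)"


definition linear_connection ::
    "('a, 'b::real_normed_vector) chart set \<Rightarrow> ('a vfield \<Rightarrow> 'a vfield \<Rightarrow> 'a vfield) \<Rightarrow> bool" where
  "linear_connection A D \<longleftrightarrow>
     (\<forall>X\<in>vector_fields A. \<forall>Y\<in>vector_fields A. D X Y \<in> vector_fields A) \<and>
     (\<forall>X\<in>vector_fields A. \<forall>X'\<in>vector_fields A. \<forall>Y\<in>vector_fields A.
        D (X + X') Y = D X Y + D X' Y) \<and>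
     (\<forall>f\<in>smooth_fun A. \<forall>X\<in>vector_fields A. \<forall>Y\<in>vector_fields A.
        D (\<lambda>p. f p *\<^sub>R X p) Y = (\<lambda>p. f p *\<^sub>R D X Y p)) \<and>
     (\<forall>X\<in>vector_fields A. \<forall>Y\<in>vector_fields A. \<forall>Y'\<in>vector_fields A.
        D X (Y + Y') = D X Y + D X Y') \<and>
     (\<forall>c. \<forall>X\<in>vector_fields A. \<forall>Y\<in>vector_fields A. D X (c *\<^sub>R Y) = c *\<^sub>R D X Y) \<and>
     (\<forall>f\<in>smooth_fun A. \<forall>X\<in>vector_fields A. \<forall>Y\<in>vector_fields A.
        D X (\<lambda>p. f p *\<^sub>R Y p) = (\<lambda>p. X p f *\<^sub>R Y p + f p *\<^sub>R D X Y p))"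

definition conj_connection ::
    "('a vfield \<Rightarrow> 'a vfield \<Rightarrow> 'a vfield) \<Rightarrow> 'a endo \<Rightarrow> 'a vfield \<Rightarrow> 'a vfield \<Rightarrow> 'a vfield" where
  "conj_connection D E X Y = E \<star> D X (E \<star> Y)"

definition cov_deriv_endo ::
    "('a vfield \<Rightarrow> 'a vfield \<Rightarrow> 'a vfield) \<Rightarrow> 'a endo \<Rightarrow> 'a vfield \<Rightarrow> 'a vfield \<Rightarrow> 'a vfield" where
  "cov_deriv_endo D E X Y = D X (E \<star> Y) - E \<star> D X Y"

definition form_tensor :: "('a \<Rightarrow> 'a tvec \<Rightarrow> real) \<Rightarrow> 'a endo \<Rightarrow> 'a vfield \<Rightarrow> 'a vfield \<Rightarrow> 'a vfield" where
  "form_tensor \<eta> F X Y = (\<lambda>p. \<eta> p (X p) *\<^sub>R F p (Y p))"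

definition eq_on_fields :: "('a, 'b::real_normed_vector) chart set \<Rightarrow>
    ('a vfield \<Rightarrow> 'a vfield \<Rightarrow> 'a vfield) \<Rightarrow> ('a vfield \<Rightarrow> 'a vfield \<Rightarrow> 'a vfield) \<Rightarrow> bool" where
  "eq_on_fields A S T \<longleftrightarrow> (\<forall>X\<in>vector_fields A. \<forall>Y\<in>vector_fields A. S X Y = T X Y)"

end

theory Submission
  imports Defs
begin

text \<open>
  Everything is a fibrewise computation once \<open>D X\<close> is known to be linear on vector fields.  In
  case (ii), expanding the conjugate connection of \<open>Eab\<close> leaves the additional term
  \<open>2 * \<alpha> * \<beta>\<close> times \<open>\<eta> \<otimes> I\<close>, which is absent from the claim.  It vanishes because applying
  \<open>D X\<close> to \<open>E1 E2 Y + E2 E1 Y = 0\<close> gives \<open>4 \<eta>(X) Y = 0\<close>.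
\<close>

section \<open>Differentiability classes on open sets: locality and linearity\<close>

text \<open>The derivative at a point of the open set \<open>S\<close> depends only on values near
  that point, so agreement on \<open>S\<close> passes to all directional derivatives. This allows
  derivatives that are computed only at points of \<open>S\<close> to replace
  \<open>frechet_derivative\<close> in the closure proofs below.\<close>

lemma Ck_on_cong:
  assumes "open S" and "\<And>x. x \<in> S \<Longrightarrow> f x = g x" and "Ck_on k S f"
  shows "Ck_on k S g"
  using assms(2,3)
proof (induction k arbitrary: f g)
  case 0
  then show ?case
    using continuous_on_cong[of S S f g] by simp
next
  case (Suc k)
  show ?case
    unfolding Ck_on.simps
  proof (intro conjI ballI allI)
    fix x assume "x \<in> S"
    then have "(f has_derivative frechet_derivative f (at x)) (at x)"
      using Suc.prems(2) frechet_derivative_works by auto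
    then have "(g has_derivative frechet_derivative f (at x)) (at x)"
      using \<open>open S\<close> \<open>x \<in> S\<close> Suc.prems(1) by (rule has_derivative_transform_within_open)
    then show "g differentiable at x"
      by (rule differentiableI)
  next
    fix v
    have "frechet_derivative f (at x) v = frechet_derivative g (at x) v" if "x \<in> S" for x
      using frechet_derivative_transform_within_open[of f x S g] Suc.prems \<open>open S\<close> that by auto
    moreover have "Ck_on k S (\<lambda>x. frechet_derivative f (at x) v)"
      using Suc.prems(2) by simp
    ultimately show "Ck_on k S (\<lambda>x. frechet_derivative g (at x) v)"
      by (rule Suc.IH)
  qed
qed

text \<open>The functions are arbitrary in the induction because the hypothesis is applied to their
  directional derivatives. The sum rule is available only at points of \<open>S\<close>, hence the
  final transfer by \<open>Ck_on_cong\<close>.\<close>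

lemma Ck_on_add:
  assumes "open S" and "Ck_on k S f" and "Ck_on k S g"
  shows "Ck_on k S (\<lambda>x. f x + g x)"
  using assms(2,3)
proof (induction k arbitrary: f g)
  case 0
  then show ?case
    by (simp add: continuous_on_add)
next
  case (Suc k)
  show ?case
    unfolding Ck_on.simps
  proof (intro conjI ballI allI)
    fix x assume "x \<in> S"
    then show "(\<lambda>x. f x + g x) differentiable at x"
      using Suc.prems by (intro differentiable_add) auto
  next
    fix v
    have "Ck_on k S (\<lambda>x. frechet_derivative f (at x) v + frechet_derivative g (at x) v)"
      using Suc.prems by (intro Suc.IH) auto
    moreover have "frechet_derivative f (at x) v + frechet_derivative g (at x) v =
        frechet_derivative (\<lambda>x. f x + g x) (at x) v" if "x \<in> S" for x
    proof -
      have "((\<lambda>x. f x + g x) has_derivative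
          (\<lambda>v. frechet_derivative f (at x) v + frechet_derivative g (at x) v)) (at x)"
        using Suc.prems that frechet_derivative_works by (intro has_derivative_add) auto
      from frechet_derivative_at[OF this] show ?thesis
        by metis
    qed
    ultimately show "Ck_on k S (\<lambda>x. frechet_derivative (\<lambda>x. f x + g x) (at x) v)"
      by (rule Ck_on_cong[OF \<open>open S\<close>, rotated])
  qed
qed

lemma Ck_on_scaleR:
  assumes "open S" and "Ck_on k S f"
  shows "Ck_on k S (\<lambda>x. c *\<^sub>R f x)"
  using assms(2)
proof (induction k arbitrary: f)
  case 0
  then show ?case
    by (simp add: continuous_on_scaleR)
next
  case (Suc k)
  have deriv: "((\<lambda>x. c *\<^sub>R f x) has_derivative (\<lambda>v. c *\<^sub>R frechet_derivative f (at x) v)) (at x)"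
    if "x \<in> S" for x
    using Suc.prems that frechet_derivative_works by (intro has_derivative_scaleR_right) auto
  show ?case
    unfolding Ck_on.simps
  proof (intro conjI ballI allI)
    fix x assume "x \<in> S"
    then show "(\<lambda>x. c *\<^sub>R f x) differentiable at x"
      using deriv differentiableI by blast
  next
    fix v
    have "Ck_on k S (\<lambda>x. c *\<^sub>R frechet_derivative f (at x) v)"
      using Suc.prems by (intro Suc.IH) auto
    moreover have "c *\<^sub>R frechet_derivative f (at x) v =
        frechet_derivative (\<lambda>x. c *\<^sub>R f x) (at x) v" if "x \<in> S" for x
      using frechet_derivative_at[OF deriv[OF that]] by metis
    ultimately show "Ck_on k S (\<lambda>x. frechet_derivative (\<lambda>x. c *\<^sub>R f x) (at x) v)"
      by (rule Ck_on_cong[OF \<open>open S\<close>, rotated])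
  qed
qed

section \<open>Linear structure on smooth functions\<close>

lemma smooth_fun_add:
  assumes "smooth_manifold A" and "f \<in> smooth_fun A" and "g \<in> smooth_fun A"
  shows "f + g \<in> smooth_fun A"
proof -
  have "smooth_on (\<phi> ` U) ((f + g) \<circ> inv_into U \<phi>)" if "(U, \<phi>) \<in> A" for U \<phi>
  proof -
    have "open (\<phi> ` U)"
      using assms(1) that by (auto simp: smooth_manifold_def)
    moreover have "smooth_on (\<phi> ` U) (f \<circ> inv_into U \<phi>)" "smooth_on (\<phi> ` U) (g \<circ> inv_into U \<phi>)"
      using assms(2,3) that by (auto simp: smooth_fun_def)
    ultimately show ?thesis
      using Ck_on_add[of "\<phi> ` U" _ "f \<circ> inv_into U \<phi>" "g \<circ> inv_into U \<phi>"]
      by (simp add: smooth_on_def o_def)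
  qed
  then show ?thesis
    by (auto simp: smooth_fun_def)
qed

lemma smooth_fun_scaleR:
  assumes "smooth_manifold A" and "f \<in> smooth_fun A"
  shows "c *\<^sub>R f \<in> smooth_fun A"
proof -
  have "smooth_on (\<phi> ` U) ((c *\<^sub>R f) \<circ> inv_into U \<phi>)" if "(U, \<phi>) \<in> A" for U \<phi>
  proof -
    have "open (\<phi> ` U)"
      using assms(1) that by (auto simp: smooth_manifold_def)
    moreover have "smooth_on (\<phi> ` U) (f \<circ> inv_into U \<phi>)"
      using assms(2) that by (auto simp: smooth_fun_def)
    ultimately show ?thesis
      using Ck_on_scaleR[of "\<phi> ` U" _ "f \<circ> inv_into U \<phi>" c]
      by (simp add: smooth_on_def o_def)
  qed
  then show ?thesis
    by (auto simp: smooth_fun_def)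
qed

section \<open>Linear structure on tangent spaces and vector fields\<close>

text \<open>The derivation conditions are linear in the tangent vector, and so is the convention of
  value 0 on non-smooth functions.\<close>

lemma tangent_space_add:
  assumes "u \<in> tangent_space A p" and "v \<in> tangent_space A p"
  shows "u + v \<in> tangent_space A p"
  using assms by (simp add: tangent_space_def algebra_simps)

lemma tangent_space_scaleR:
  assumes "v \<in> tangent_space A p"
  shows "c *\<^sub>R v \<in> tangent_space A p"
  using assms by (simp add: tangent_space_def algebra_simps)

lemma vector_fields_add:
  assumes "smooth_manifold A" and "X \<in> vector_fields A" and "Y \<in> vector_fields A"
  shows "X + Y \<in> vector_fields A"
proof -
  have "(\<lambda>p. (X + Y) p f) \<in> smooth_fun A" if "f \<in> smooth_fun A" for f
    using smooth_fun_add[OF assms(1), of "\<lambda>p. X p f" "\<lambda>p. Y p f"] assms(2,3) that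
    by (simp add: vector_fields_def plus_fun_def)
  then show ?thesis
    using assms(2,3) by (simp add: vector_fields_def tangent_space_add)
qed

lemma vector_fields_scaleR:
  assumes "smooth_manifold A" and "X \<in> vector_fields A"
  shows "c *\<^sub>R X \<in> vector_fields A"
proof -
  have "(\<lambda>p. (c *\<^sub>R X) p f) \<in> smooth_fun A" if "f \<in> smooth_fun A" for f
    using smooth_fun_scaleR[OF assms(1), of "\<lambda>p. X p f" c] assms(2) that
    by (simp add: vector_fields_def scaleR_fun_def)
  then show ?thesis
    using assms(2) by (simp add: vector_fields_def tangent_space_scaleR)
qed

section \<open>Linearity of connections and of bundle endomorphisms\<close>

lemma linear_connection_lincomb:
  assumes "smooth_manifold A" and "linear_connection A D"
    and "X \<in> vector_fields A" and "Y \<in> vector_fields A" and "Z \<in> vector_fields A"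
  shows "D X (a *\<^sub>R Y + b *\<^sub>R Z) = a *\<^sub>R D X Y + b *\<^sub>R D X Z"
  using assms(2-5) vector_fields_scaleR[OF assms(1)] by (simp add: linear_connection_def)

text \<open>The zero field is written as \<open>0 *\<^sub>R Y\<close> to use homogeneity. This
  serves to differentiate the anticommutation relation in case (ii).\<close>

lemma linear_connection_zero:
  assumes "linear_connection A D" and "X \<in> vector_fields A" and "Y \<in> vector_fields A"
  shows "D X 0 = 0"
proof -
  have "D X (0 *\<^sub>R Y) = 0 *\<^sub>R D X Y"
    using assms unfolding linear_connection_def by blast
  then show ?thesis
    by simp
qed

lemma linear_on_fibre_lincomb:
  assumes "linear_on_fibre A p L" and "u \<in> tangent_space A p" and "v \<in> tangent_space A p"
  shows "L (a *\<^sub>R u + b *\<^sub>R v) = a *\<^sub>R L u + b *\<^sub>R L v"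
  using assms by (simp add: linear_on_fibre_def tangent_space_scaleR)

lemma bundle_endomorphism_tangent_space:
  assumes "bundle_endomorphism A E" and "v \<in> tangent_space A p"
  shows "E p v \<in> tangent_space A p"
  using assms unfolding bundle_endomorphism_def by blast

lemma bundle_endomorphism_lincomb:
  assumes "smooth_manifold A" and "bundle_endomorphism A E" and "bundle_endomorphism A F"
  shows "bundle_endomorphism A (a *\<^sub>R E + b *\<^sub>R F)"
proof -
  have "(a *\<^sub>R E + b *\<^sub>R F) \<star> X = a *\<^sub>R (E \<star> X) + b *\<^sub>R (F \<star> X)" for X
    by (simp add: fun_eq_iff endo_app_def)
  moreover have "linear_on_fibre A p ((a *\<^sub>R E + b *\<^sub>R F) p)" for p
    using assms(2,3)
    by (auto simp: bundle_endomorphism_def linear_on_fibre_def scaleR_add_right ac_simps)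
  moreover have "(a *\<^sub>R E + b *\<^sub>R F) p v \<in> tangent_space A p" if "v \<in> tangent_space A p" for p v
    using bundle_endomorphism_tangent_space[OF assms(2) that]
      bundle_endomorphism_tangent_space[OF assms(3) that]
    by (simp add: tangent_space_add tangent_space_scaleR)
  ultimately show ?thesis
    using assms
    by (auto simp: bundle_endomorphism_def intro!: vector_fields_add vector_fields_scaleR)
qed

theorem mainTheorem3:
  fixes A :: "('a::{t2_space, second_countable_topology}, 'b::real_normed_vector) chart set"
    and D :: "'a vfield \<Rightarrow> 'a vfield \<Rightarrow> 'a vfield"
    and E1 E2 Eab :: "'a endo"
    and \<alpha> \<beta> :: real
  assumes "smooth_manifold A"
    and "linear_connection A D"
    and "almost_product_structure A E1" and "almost_product_structure A E2"
    and "\<forall>p. \<forall>v\<in>tangent_space A p. endo_comp E1 E2 p v = - endo_comp E2 E1 p v"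
    and "\<alpha>\<^sup>2 + \<beta>\<^sup>2 = 1"
    and "Eab = \<alpha> *\<^sub>R E1 + \<beta> *\<^sub>R E2"
  shows "almost_product_structure A Eab \<and>
    (\<forall>X\<in>vector_fields A. \<forall>Y\<in>vector_fields A.
       conj_connection D Eab X Y =
         \<alpha>\<^sup>2 *\<^sub>R conj_connection D E1 X Y + \<beta>\<^sup>2 *\<^sub>R conj_connection D E2 X Y
         + (\<alpha> * \<beta>) *\<^sub>R (E1 \<star> D X (E2 \<star> Y) + E2 \<star> D X (E1 \<star> Y))) \<and>
    (\<forall>\<eta>. one_form A \<eta> \<and>
       eq_on_fields A (cov_deriv_endo D E1) (form_tensor \<eta> E1) \<and>
       eq_on_fields A (cov_deriv_endo D E2) (form_tensor \<eta> E2) \<longrightarrow>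
         eq_on_fields A (conj_connection D E1) (conj_connection D E2) \<and>
         eq_on_fields A (conj_connection D Eab) (conj_connection D E1)) \<and>
    (\<forall>\<eta>. one_form A \<eta> \<and>
       eq_on_fields A (cov_deriv_endo D E1) (form_tensor \<eta> E2) \<and>
       eq_on_fields A (cov_deriv_endo D E2) (form_tensor \<eta> E1) \<longrightarrow>
         eq_on_fields A D ((1/2) *\<^sub>R (conj_connection D E1 + conj_connection D E2)) \<and>
         eq_on_fields A (conj_connection D Eab)
           (D + (\<alpha>\<^sup>2 - \<beta>\<^sup>2) *\<^sub>R form_tensor \<eta> (endo_comp E1 E2)))"
proof -

  \<comment> \<open>Fibrewise rules for \<open>E1\<close> and \<open>E2\<close>\<close>
  note M = assms(1) and conn = assms(2) and Eab = assms(7)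
  have be: "bundle_endomorphism A E1" "bundle_endomorphism A E2"
    using assms(3,4) by (simp_all add: almost_product_structure_def)
  have T: "E1 p v \<in> tangent_space A p" "E2 p v \<in> tangent_space A p"
    if "v \<in> tangent_space A p" for p v
    using be that by (simp_all add: bundle_endomorphism_tangent_space)
  have VF: "E1 \<star> X \<in> vector_fields A" "E2 \<star> X \<in> vector_fields A"
    if "X \<in> vector_fields A" for X
    using be that by (auto simp: bundle_endomorphism_def)
  have VT: "X p \<in> tangent_space A p" if "X \<in> vector_fields A" for X p
    using that by (simp add: vector_fields_def)
  have DV: "D X Y \<in> vector_fields A" if "X \<in> vector_fields A" "Y \<in> vector_fields A" for X Y
    using conn that by (simp add: linear_connection_def)
  have lin: "E1 p (a *\<^sub>R u + b *\<^sub>R v) = a *\<^sub>R E1 p u + b *\<^sub>R E1 p v"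
    "E2 p (a *\<^sub>R u + b *\<^sub>R v) = a *\<^sub>R E2 p u + b *\<^sub>R E2 p v"
    if "u \<in> tangent_space A p" "v \<in> tangent_space A p" for p u v a b
    using be that by (auto simp: bundle_endomorphism_def intro!: linear_on_fibre_lincomb)
  \<comment> \<open>The recurrence equations produce arguments of this shape, with leading
    coefficient 1.\<close>
  have lin1: "E1 p (u + c *\<^sub>R v) = E1 p u + c *\<^sub>R E1 p v"
    "E2 p (u + c *\<^sub>R v) = E2 p u + c *\<^sub>R E2 p v"
    if "u \<in> tangent_space A p" "v \<in> tangent_space A p" for p u v c
    using lin[OF that, of 1 c] by simp_all
  have sq: "E1 p (E1 p v) = v" "E2 p (E2 p v) = v" if "v \<in> tangent_space A p" for p v
    using assms(3,4) that by (simp_all add: almost_product_structure_def endo_comp_def)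
  \<comment> \<open>As a rewrite rule this brings every mixed product into the order
    \<open>E1 p (E2 p v)\<close>.\<close>
  have anti: "E2 p (E1 p v) = - E1 p (E2 p v)" if "v \<in> tangent_space A p" for p v
    using assms(5) that by (simp add: endo_comp_def)
  \<comment> \<open>The constraint on \<alpha> and \<beta> enters through this identity
    alone.\<close>
  have ab: "\<alpha>\<^sup>2 *\<^sub>R v + \<beta>\<^sup>2 *\<^sub>R v = v" for v :: "'a tvec"
    using assms(6) by (metis scaleR_add_left scaleR_one)
  have appE: "Eab p v = \<alpha> *\<^sub>R E1 p v + \<beta> *\<^sub>R E2 p v" for p v
    by (simp add: Eab)

  \<comment> \<open>The combination \<open>Eab\<close> squares to the identity\<close>
  have aps: "almost_product_structure A Eab"
  proof -
    have "Eab p (Eab p v) = v" if "v \<in> tangent_space A p" for p v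
    proof -
      \<comment> \<open>The mixed terms carry the coefficient \<open>\<alpha> * \<beta>\<close> and
        cancel by anticommutation.\<close>
      have "Eab p (Eab p v) = \<alpha>\<^sup>2 *\<^sub>R v + \<beta>\<^sup>2 *\<^sub>R v"
        by (simp only: appE lin[OF T[OF that]] sq[OF that] anti[OF that])
          (simp add: algebra_simps power2_eq_square)
      then show ?thesis
        by (simp only: ab)
    qed
    moreover have "bundle_endomorphism A Eab"
      unfolding Eab by (rule bundle_endomorphism_lincomb[OF M be])
    ultimately show ?thesis
      by (simp add: almost_product_structure_def endo_comp_def)
  qed

  \<comment> \<open>The general formula, by bilinear expansion\<close>
  have conj: "conj_connection D Eab X Y =
      \<alpha>\<^sup>2 *\<^sub>R conj_connection D E1 X Y + \<beta>\<^sup>2 *\<^sub>R conj_connection D E2 X Y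
      + (\<alpha> * \<beta>) *\<^sub>R (E1 \<star> D X (E2 \<star> Y) + E2 \<star> D X (E1 \<star> Y))"
    if X: "X \<in> vector_fields A" and Y: "Y \<in> vector_fields A" for X Y
  proof
    fix p
    have "Eab \<star> Y = \<alpha> *\<^sub>R (E1 \<star> Y) + \<beta> *\<^sub>R (E2 \<star> Y)"
      by (simp add: fun_eq_iff endo_app_def appE)
    then have "D X (Eab \<star> Y) = \<alpha> *\<^sub>R D X (E1 \<star> Y) + \<beta> *\<^sub>R D X (E2 \<star> Y)"
      by (simp only: linear_connection_lincomb[OF M conn X VF(1)[OF Y] VF(2)[OF Y]])
    then have eq: "conj_connection D Eab X Y p =
        Eab p (\<alpha> *\<^sub>R D X (E1 \<star> Y) p + \<beta> *\<^sub>R D X (E2 \<star> Y) p)"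
      by (simp add: conj_connection_def endo_app_def)
    show "conj_connection D Eab X Y p =
      (\<alpha>\<^sup>2 *\<^sub>R conj_connection D E1 X Y + \<beta>\<^sup>2 *\<^sub>R conj_connection D E2 X Y
      + (\<alpha> * \<beta>) *\<^sub>R (E1 \<star> D X (E2 \<star> Y) + E2 \<star> D X (E1 \<star> Y))) p"
      unfolding eq appE lin[OF VT[OF DV[OF X VF(1)[OF Y]]] VT[OF DV[OF X VF(2)[OF Y]]]]
      by (simp add: conj_connection_def endo_app_def scaleR_add_right power2_eq_square mult.commute)
  qed
  \<comment> \<open>Stated for two endomorphisms so as to serve both cases: \<open>F\<close> is
    \<open>E\<close> itself in (i) and the other structure in (ii).\<close>
  have recurrence: "D X (E \<star> Y) p = E p (D X Y p) + \<eta> p (X p) *\<^sub>R F p (Y p)"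
    if "eq_on_fields A (cov_deriv_endo D E) (form_tensor \<eta> F)"
      and "X \<in> vector_fields A" and "Y \<in> vector_fields A" for E F \<eta> X Y p
  proof -
    have "(D X (E \<star> Y) - E \<star> D X Y) p = \<eta> p (X p) *\<^sub>R F p (Y p)"
      using that by (simp add: eq_on_fields_def cov_deriv_endo_def form_tensor_def)
    then show ?thesis
      by (simp add: endo_app_def algebra_simps)
  qed

  \<comment> \<open>Case (i): a common form of recurrence\<close>
  have i: "conj_connection D E1 X Y = conj_connection D E2 X Y \<and>
      conj_connection D Eab X Y = conj_connection D E1 X Y"
    if e1: "eq_on_fields A (cov_deriv_endo D E1) (form_tensor \<eta> E1)"
      and e2: "eq_on_fields A (cov_deriv_endo D E2) (form_tensor \<eta> E2)"
      and X: "X \<in> vector_fields A" and Y: "Y \<in> vector_fields A" for \<eta> X Y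
  proof -
    note t = VT[OF DV[OF X Y]] VT[OF Y]
    \<comment> \<open>Applying \<open>E1\<close> to the recurrence equation cancels both occurrences
      of \<open>E1\<close>, so the result does not depend on the structure. Only the outer
      \<open>\<star>\<close> is unfolded, since \<open>recurrence\<close> has to match the inner
      one.\<close>
    have c1: "conj_connection D E1 X Y p = D X Y p + \<eta> p (X p) *\<^sub>R Y p" for p
      by (simp add: conj_connection_def endo_app_def[of E1 "D _ _"] recurrence[OF e1 X Y]
          lin1 T t sq)
    have c2: "conj_connection D E2 X Y p = D X Y p + \<eta> p (X p) *\<^sub>R Y p" for p
      by (simp add: conj_connection_def endo_app_def[of E2 "D _ _"] recurrence[OF e2 X Y]
          lin1 T t sq)
    \<comment> \<open>Both summands apply a mixed product to the same vector
      \<open>D X Y p + \<eta> p (X p) *\<^sub>R Y p\<close>, in opposite orders.\<close>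
    have "(E1 \<star> D X (E2 \<star> Y) + E2 \<star> D X (E1 \<star> Y)) p = 0" for p
      by (simp add: endo_app_def[of _ "D _ _"] recurrence[OF e1 X Y] recurrence[OF e2 X Y]
          lin1 T t anti fun_eq_iff)
    then have mixed: "E1 \<star> D X (E2 \<star> Y) + E2 \<star> D X (E1 \<star> Y) = 0"
      by (simp add: fun_eq_iff)
    have c12: "conj_connection D E1 X Y = conj_connection D E2 X Y"
      by (rule ext) (simp only: c1 c2)
    moreover have "conj_connection D Eab X Y p = conj_connection D E1 X Y p" for p
      using ab[of "conj_connection D E2 X Y p"] by (simp add: conj[OF X Y] mixed c12)
    ultimately show ?thesis
      by blast
  qed

  \<comment> \<open>Case (ii): exchanged recurrence\<close>
  have ii: "D X Y = ((1/2) *\<^sub>R (conj_connection D E1 + conj_connection D E2)) X Y \<and>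
      conj_connection D Eab X Y =
        (D + (\<alpha>\<^sup>2 - \<beta>\<^sup>2) *\<^sub>R form_tensor \<eta> (endo_comp E1 E2)) X Y"
    if e1: "eq_on_fields A (cov_deriv_endo D E1) (form_tensor \<eta> E2)"
      and e2: "eq_on_fields A (cov_deriv_endo D E2) (form_tensor \<eta> E1)"
      and X: "X \<in> vector_fields A" and Y: "Y \<in> vector_fields A" for \<eta> X Y
  proof -
    note t = VT[OF DV[OF X Y]] VT[OF Y]
    have c1: "conj_connection D E1 X Y p = D X Y p + \<eta> p (X p) *\<^sub>R E1 p (E2 p (Y p))" for p
      by (simp add: conj_connection_def endo_app_def[of E1 "D _ _"] recurrence[OF e1 X Y]
          lin1 T t sq)
    \<comment> \<open>Anticommutation gives the correction the sign opposite to that in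
      \<open>c1\<close>, so the mean of the two conjugate connections is \<open>D\<close>.\<close>
    have c2: "conj_connection D E2 X Y p = D X Y p - \<eta> p (X p) *\<^sub>R E1 p (E2 p (Y p))" for p
      by (simp add: conj_connection_def endo_app_def[of E2 "D _ _"] recurrence[OF e2 X Y]
          lin1 T t sq anti)
    have d1: "(E1 \<star> D X (E2 \<star> Y)) p = E1 p (E2 p (D X Y p)) + \<eta> p (X p) *\<^sub>R Y p" for p
      by (simp add: endo_app_def[of E1 "D _ _"] recurrence[OF e2 X Y] lin1 T t sq)
    have d2: "(E2 \<star> D X (E1 \<star> Y)) p = - E1 p (E2 p (D X Y p)) + \<eta> p (X p) *\<^sub>R Y p" for p
      by (simp add: endo_app_def[of E2 "D _ _"] recurrence[OF e1 X Y] lin1 T t sq anti)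
    \<comment> \<open>Of the four copies of \<open>\<eta> p (X p) *\<^sub>R Y p\<close>, two come
      from differentiating the outer structures and two from \<open>d1\<close> and
      \<open>d2\<close>; the terms in \<open>E1 p (E2 p (D X Y p))\<close> cancel.\<close>
    have vanish: "\<eta> p (X p) *\<^sub>R Y p = 0" for p
    proof -
      have "E1 \<star> E2 \<star> Y + E2 \<star> E1 \<star> Y = 0"
        by (simp add: fun_eq_iff endo_app_def anti t)
      then have "D X (E1 \<star> E2 \<star> Y) + D X (E2 \<star> E1 \<star> Y) = 0"
        using linear_connection_lincomb[OF M conn X VF(1)[OF VF(2)[OF Y]] VF(2)[OF VF(1)[OF Y]],
            of 1 1] linear_connection_zero[OF conn X Y] by simp
      then have "D X (E1 \<star> E2 \<star> Y) p + D X (E2 \<star> E1 \<star> Y) p = 0"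
        by (metis plus_fun_apply zero_fun_apply)
      moreover have "D X (E1 \<star> E2 \<star> Y) p = (E1 \<star> D X (E2 \<star> Y)) p + \<eta> p (X p) *\<^sub>R Y p"
        unfolding recurrence[OF e1 X VF(2)[OF Y]] by (simp add: endo_app_def sq t)
      moreover have "D X (E2 \<star> E1 \<star> Y) p = (E2 \<star> D X (E1 \<star> Y)) p + \<eta> p (X p) *\<^sub>R Y p"
        unfolding recurrence[OF e2 X VF(1)[OF Y]] by (simp add: endo_app_def sq t)
      ultimately have "4 *\<^sub>R (\<eta> p (X p) *\<^sub>R Y p) = 0"
        using d1[of p] d2[of p] by (simp add: fun_eq_iff)
      then show ?thesis
        by simp
    qed
    have "E1 \<star> D X (E2 \<star> Y) + E2 \<star> D X (E1 \<star> Y) = 0"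
      by (rule ext) (simp only: plus_fun_apply zero_fun_apply d1 d2 vanish
          add_0_right add.right_inverse)
    then have "conj_connection D Eab X Y p =
        \<alpha>\<^sup>2 *\<^sub>R conj_connection D E1 X Y p + \<beta>\<^sup>2 *\<^sub>R conj_connection D E2 X Y p" for p
      by (simp add: conj[OF X Y])
    \<comment> \<open>The multiples of \<open>D X Y p\<close> are grouped for \<open>ab\<close>.
      Nested scalars are kept apart so that the last term matches the unfolded
      \<open>form_tensor\<close>.\<close>
    then have "conj_connection D Eab X Y p =
        (\<alpha>\<^sup>2 *\<^sub>R D X Y p + \<beta>\<^sup>2 *\<^sub>R D X Y p)
          + (\<alpha>\<^sup>2 - \<beta>\<^sup>2) *\<^sub>R \<eta> p (X p) *\<^sub>R E1 p (E2 p (Y p))" for p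
      by (simp add: c1 c2 scaleR_add_right scaleR_diff_right scaleR_diff_left
          del: scaleR_scaleR)
    then have "conj_connection D Eab X Y =
        (D + (\<alpha>\<^sup>2 - \<beta>\<^sup>2) *\<^sub>R form_tensor \<eta> (endo_comp E1 E2)) X Y"
      by - (rule ext,
        simp only: ab plus_fun_apply scaleR_fun_apply form_tensor_def endo_comp_def)
    moreover have "D X Y = ((1/2) *\<^sub>R (conj_connection D E1 + conj_connection D E2)) X Y"
      by (rule ext)+ (simp add: c1 c2)
    ultimately show ?thesis
      by blast
  qed
  \<comment> \<open>Unfolding only these instances leaves the hypotheses on
    \<open>cov_deriv_endo\<close> folded, as the premises of \<open>i\<close> and \<open>ii\<close>
    expect them.\<close>
  show ?thesis
    unfolding eq_on_fields_def[of A "conj_connection D _"] eq_on_fields_def[of A D]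
    using aps conj i ii by blast
qed

end
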